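(* There exists $(\lambda,\mu)$ with $0<\lambda<\mu<1$ and $\lambda+\mu>1$ such that the set $A_{\lambda,\mu}$ has box dimension strictly greater than $1$.
   Context: For $0<\lambda<\mu<1$ with $\lambda+\mu>1$, define maps of the plane $$T_0(x,y)=(\lambda x,\mu y),\qquad T_1(x,y)=(\mu x+1-\mu,\ \lambda y+1-\lambda),$$ and let $A_{\lambda,\mu}$ be the attractor of the iterated function system $\{T_0,T_1\}$, i.e. the unique non-empty compact set $A\subset\mathbb{R}^2$ with $A=T_0(A)\cup T_1(A)$. *)

theory Defs
  imports "HOL-Analysis.Analysis"
begin

definition T0 :: "real \<Rightarrow> real \<Rightarrow> real \<times> real \<Rightarrow> real \<times> real" where
  "T0 lam mu = (\<lambda>(x, y). (lam * x, mu * y))"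

definition T1 :: "real \<Rightarrow> real \<Rightarrow> real \<times> real \<Rightarrow> real \<times> real" where
  "T1 lam mu = (\<lambda>(x, y). (mu * x + 1 - mu, lam * y + 1 - lam))"

text \<open>For parameters in (0, 1) both maps are contractions, so by Hutchinson's theorem exactly one
  set satisfies the description; outside that range the value carries no meaning.\<close>

definition attractor :: "real \<Rightarrow> real \<Rightarrow> (real \<times> real) set" where
  "attractor lam mu =
     (THE A. A \<noteq> {} \<and> compact A \<and> A = T0 lam mu ` A \<union> T1 lam mu ` A)"

text \<open>Smallest number of sets of diameter at most \<open>\<delta>\<close> that cover \<open>E\<close>. The library's
  \<^const>\<open>diameter\<close> is only meaningful on bounded sets, hence the explicit boundedness. For bounded
  \<open>E\<close> and \<open>\<delta> > 0\<close> a finite cover exists, so the minimum is attained.\<close>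

definition covering_number :: "real \<Rightarrow> 'a::euclidean_space set \<Rightarrow> nat" where
  "covering_number \<delta> E =
     (LEAST n. \<exists>C. finite C \<and> card C = n \<and> (\<forall>U\<in>C. bounded U \<and> diameter U \<le> \<delta>) \<and> E \<subseteq> \<Union>C)"

text \<open>\<open>has_box_dimension E d\<close> says that the box (Minkowski) dimension of \<open>E\<close> exists, i.e. that the
  lower and upper box dimensions coincide, and that it equals \<open>d\<close>.\<close>

definition has_box_dimension :: "'a::euclidean_space set \<Rightarrow> real \<Rightarrow> bool" where
  "has_box_dimension E d \<longleftrightarrow>
     E \<noteq> {} \<and> bounded E \<and>
     ((\<lambda>\<delta>. ln (real (covering_number \<delta> E)) / (- ln \<delta>)) \<longlongrightarrow> d) (at_right 0)"

end

theory Submission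
  imports Defs "HOL-Real_Asymp.Real_Asymp"
begin

text \<open>For \<open>\<mu> = 99/100\<close> and \<open>\<lambda> = \<mu>\<^sup>2\<close> the attractor even has interior points, hence box dimension 2.
  A compact set \<open>U\<close> with \<open>U \<subseteq> T\<^sub>0(U) \<union> T\<^sub>1(U)\<close> lies in the attractor, so it suffices to find such a \<open>U\<close>
  with interior points. As \<open>\<lambda> = \<mu>\<^sup>2\<close>, the inverse of \<open>T\<^sub>0\<close> preserves every region \<open>y\<^sup>2 \<le> k x\<close> and the
  inverse of \<open>T\<^sub>1\<close> preserves every region \<open>1 - y \<le> k (1 - x)\<^sup>2\<close>. For \<open>k\<close> slightly below 1 these two
  parabolic regions meet in a lens. The inverse of \<open>T\<^sub>0\<close> can leave the lens only across its lower
  arc, that of \<open>T\<^sub>1\<close> only across its upper arc, and when the steps are small compared with the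
  thickness of the lens, at every point one of the two stays inside.\<close>

section \<open>Compact invariant sets of two contractions\<close>

text \<open>The distance to \<open>C\<close> attains its maximum over \<open>U\<close> at some
  \<open>u\<close>, which is \<open>f v\<close> or \<open>g v\<close> with \<open>v\<close> in
  \<open>U\<close>. Both maps shrink this distance by the factor \<open>c\<close>, so the maximum is
  at most \<open>c\<close> times itself and hence 0.\<close>

lemma backward_invariant_subset:
  fixes f g :: "'a::heine_borel \<Rightarrow> 'a"
  assumes c: "0 \<le> c" "c < 1"
    and f: "\<And>x y. dist (f x) (f y) \<le> c * dist x y"
    and g: "\<And>x y. dist (g x) (g y) \<le> c * dist x y"
    and U: "compact U" "U \<subseteq> f ` U \<union> g ` U"
    and C: "compact C" "C \<noteq> {}" "f ` C \<union> g ` C \<subseteq> C"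
  shows "U \<subseteq> C"
proof (cases "U = {}")
  case False
  have step: "infdist (h x) C \<le> c * infdist x C"
    if h: "\<And>x y. dist (h x) (h y) \<le> c * dist x y" "h ` C \<subseteq> C" for h :: "'a \<Rightarrow> 'a" and x
  proof -
    obtain y where y: "y \<in> C" "infdist x C = dist x y"
      using infdist_attains_inf[OF compact_imp_closed[OF C(1)] C(2)] by metis
    have "infdist (h x) C \<le> dist (h x) (h y)"
      using y h by (intro infdist_le) auto
    then show ?thesis using h(1)[of x y] y by simp
  qed
  obtain u where u: "u \<in> U" "\<And>x. x \<in> U \<Longrightarrow> infdist x C \<le> infdist u C"
    using continuous_attains_sup[OF U(1) False, of "\<lambda>x. infdist x C"]
    using continuous_on_infdist[OF continuous_on_id, of U C] by blast
  obtain v where v: "v \<in> U" "u = f v \<or> u = g v" using u U by blast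
  have "infdist u C \<le> c * infdist v C"
    using v(2) step[of f v] step[of g v] f g C(3) by auto
  also have "\<dots> \<le> c * infdist u C" using u v c by (intro mult_left_mono) auto
  finally have "(1 - c) * infdist u C \<le> 0" by (simp add: algebra_simps)
  then have "infdist u C \<le> 0" using c by (simp add: mult_le_0_iff)
  then have "infdist x C = 0" if "x \<in> U" for x
    using u(2)[OF that] infdist_nonneg[of x C] by linarith
  then show ?thesis
    using in_closed_iff_infdist_zero[OF compact_imp_closed[OF C(1)] C(2)] by blast
qed simp

text \<open>The union of all backward invariant subsets of \<open>K\<close> is invariant by Knaster--Tarski, and closed
  because closures of backward invariant sets are backward invariant.\<close>
lemma ex_compact_invariant:
  fixes f g :: "'a::heine_borel \<Rightarrow> 'a"
  assumes cont: "continuous_on K f" "continuous_on K g"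
    and K: "compact K" "f ` K \<union> g ` K \<subseteq> K"
    and p: "p \<in> K" "f p = p"
  shows "\<exists>A. A \<noteq> {} \<and> compact A \<and> A = f ` A \<union> g ` A"
proof -
  define A where "A = \<Union>{X. X \<subseteq> K \<and> X \<subseteq> f ` X \<union> g ` X}"
  have maximal: "X \<subseteq> A" if "X \<subseteq> K" "X \<subseteq> f ` X \<union> g ` X" for X
    using that by (auto simp: A_def)
  have AK: "A \<subseteq> K" by (auto simp: A_def)
  have post: "A \<subseteq> f ` A \<union> g ` A"
    unfolding A_def by blast
  have "f ` A \<union> g ` A \<subseteq> A"
    using AK post K(2) by (intro maximal) (blast+)
  moreover have "closure A \<subseteq> A"
  proof (rule maximal)
    show clK: "closure A \<subseteq> K"
      using AK K(1) by (simp add: closure_minimal compact_imp_closed)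
    then have "compact (closure A)"
      using K(1) by (metis closed_closure compact_Int_closed inf.absorb_iff2)
    then have "compact (f ` closure A \<union> g ` closure A)"
      using cont clK by (intro compact_Un compact_continuous_image) (auto intro: continuous_on_subset)
    moreover have "A \<subseteq> f ` closure A \<union> g ` closure A"
      using post closure_subset by blast
    ultimately show "closure A \<subseteq> f ` closure A \<union> g ` closure A"
      by (simp add: closure_minimal compact_imp_closed)
  qed
  then have "closed A" by (metis closure_subset closure_closed closed_closure subset_antisym)
  then have "compact A" using AK K(1) by (metis compact_Int_closed inf.absorb_iff2)
  \<comment> \<open>Non-emptiness comes from the fixed point, as \<open>{p}\<close> is backward
    invariant.\<close>
  moreover have "p \<in> A" using maximal[of "{p}"] p by auto
  ultimately show ?thesis using post by blast
qed

section \<open>Contraction estimates and the attractor of \<open>T0\<close> and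
  \<open>T1\<close>\<close>

lemma dist_T0_le:
  assumes "0 < lam" "lam < mu"
  shows "dist (T0 lam mu p) (T0 lam mu q) \<le> mu * dist p q"
proof -
  obtain a b c d where pq: "p = (a, b)" "q = (c, d)" by (cases p, cases q)
  have "(lam * a - lam * c)\<^sup>2 + (mu * b - mu * d)\<^sup>2 = lam\<^sup>2 * (a - c)\<^sup>2 + mu\<^sup>2 * (b - d)\<^sup>2"
    by algebra
  also have "\<dots> \<le> mu\<^sup>2 * (a - c)\<^sup>2 + mu\<^sup>2 * (b - d)\<^sup>2"
    using assms by (intro add_right_mono mult_right_mono power_mono) auto
  finally have "sqrt ((lam * a - lam * c)\<^sup>2 + (mu * b - mu * d)\<^sup>2) \<le> sqrt (mu\<^sup>2 * ((a - c)\<^sup>2 + (b - d)\<^sup>2))"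
    by (simp add: distrib_left)
  then show ?thesis
    using assms by (simp add: pq T0_def dist_Pair_Pair dist_real_def real_sqrt_mult)
qed

lemma dist_T1_le:
  assumes "0 < lam" "lam < mu"
  shows "dist (T1 lam mu p) (T1 lam mu q) \<le> mu * dist p q"
proof -
  \<comment> \<open>Up to a translation, \<open>T1\<close> is \<open>T0\<close> conjugated by the
    coordinate swap, which is an isometry.\<close>
  have "T1 lam mu p = prod.swap (T0 lam mu (prod.swap p)) + (1 - mu, 1 - lam)" for p
    by (cases p) (simp add: T0_def T1_def)
  moreover have "dist (prod.swap x) (prod.swap y) = dist x y" for x y :: "real \<times> real"
    by (cases x, cases y) (simp add: dist_Pair_Pair add.commute)
  ultimately show ?thesis using dist_T0_le[OF assms, of "prod.swap p" "prod.swap q"] by simp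
qed

text \<open>Existence comes from the unit square, which both maps send into itself; two invariant
  compact sets contain each other by \<open>backward_invariant_subset\<close>. So the
  \<open>THE\<close> in \<open>attractor\<close> is well defined.\<close>

lemma
  assumes "0 < lam" "lam < mu" "mu < 1"
  shows attractor_invariant:
      "attractor lam mu \<noteq> {} \<and> compact (attractor lam mu) \<and>
       attractor lam mu = T0 lam mu ` attractor lam mu \<union> T1 lam mu ` attractor lam mu"
    and backward_invariant_subset_attractor:
      "compact U \<Longrightarrow> U \<subseteq> T0 lam mu ` U \<union> T1 lam mu ` U \<Longrightarrow> U \<subseteq> attractor lam mu"
proof -
  let ?P = "\<lambda>A. A \<noteq> {} \<and> compact A \<and> A = T0 lam mu ` A \<union> T1 lam mu ` A"
  note sub = backward_invariant_subset[of mu "T0 lam mu" "T1 lam mu",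
      OF _ assms(3) dist_T0_le[OF assms(1,2)] dist_T1_le[OF assms(1,2)]]
  have mu: "0 \<le> mu" using assms by simp
  let ?K = "{0..1} \<times> {0..1} :: (real \<times> real) set"
  have "\<exists>A. ?P A"
  proof (rule ex_compact_invariant)
    show "continuous_on ?K (T0 lam mu)" "continuous_on ?K (T1 lam mu)"
      by (auto simp: T0_def T1_def case_prod_beta intro!: continuous_intros)
    show "compact ?K" by (intro compact_Times) auto
    have 1: "lam * x + 1 - lam \<le> 1" "0 \<le> lam * x + 1 - lam" "mu * x + 1 - mu \<le> 1" "0 \<le> mu * x + 1 - mu"
      "lam * x \<le> 1" "mu * x \<le> 1"
      if "0 \<le> x" "x \<le> 1" for x
      using that assms mult_left_le[of x lam] mult_left_le[of x mu] mult_nonneg_nonneg[of lam x]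
        mult_nonneg_nonneg[of mu x] by linarith+
    show "T0 lam mu ` ?K \<union> T1 lam mu ` ?K \<subseteq> ?K"
      using assms 1 by (auto simp: T0_def T1_def)
    show "(0, 0) \<in> ?K" "T0 lam mu (0, 0) = (0, 0)" by (auto simp: T0_def)
  qed
  then obtain A where A: "?P A" ..
  moreover have "B = A" if "?P B" for B
    using sub[OF mu, of A B] sub[OF mu, of B A] A that by (metis order_refl subset_antisym)
  ultimately have *: "?P (attractor lam mu)"
    unfolding attractor_def by (rule theI)
  then show "?P (attractor lam mu)" .
  show "U \<subseteq> attractor lam mu" if "compact U" "U \<subseteq> T0 lam mu ` U \<union> T1 lam mu ` U"
    using sub[OF mu that] * by blast
qed

section \<open>Box dimension of bounded sets with interior points\<close>

text \<open>Volume comparison: the balls of radius \<open>r\<close> about the points of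
  \<open>S\<close> are disjoint and lie in a ball of radius \<open>R + r\<close>.\<close>

lemma card_separated_le:
  fixes S :: "'a::euclidean_space set"
  assumes S: "finite S" "S \<subseteq> cball 0 R" "\<And>x y. x \<in> S \<Longrightarrow> y \<in> S \<Longrightarrow> x \<noteq> y \<Longrightarrow> 2 * r \<le> dist x y"
    and r: "0 < r" and R: "0 \<le> R"
  shows "real (card S) \<le> ((R + r) / r) ^ DIM('a)"
proof -
  let ?v = "unit_ball_vol (real DIM('a))"
  have "real (card S) * (?v * r ^ DIM('a)) = (\<Sum>x\<in>S. measure lborel (ball x r))"
    using r by (simp add: content_ball)
  also have "\<dots> = measure lborel (\<Union>x\<in>S. ball x r)"
  proof (rule measure_finite_Union[symmetric])
    have "ball x r \<inter> ball y r = {}" if "x \<in> S" "y \<in> S" "x \<noteq> y" for x y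
      using S(3)[OF that] by (intro disjoint_ballI) simp
    then show "disjoint_family_on (\<lambda>x. ball x r) S"
      by (auto simp: disjoint_family_on_def)
    show "emeasure lborel (ball x r) \<noteq> \<infinity>" for x :: 'a
      using emeasure_bounded_finite[of "ball x r"] by simp
  qed (use S in auto)
  also have "\<dots> \<le> measure lborel (cball (0::'a) (R + r))"
  proof (rule measure_mono_fmeasurable)
    show "(\<Union>x\<in>S. ball x r) \<subseteq> cball 0 (R + r)"
    proof clarify
      fix x z assume "x \<in> S" "z \<in> ball x r"
      then have "norm x \<le> R" "norm (z - x) < r" using S(2) by (auto simp: dist_norm norm_minus_commute)
      then show "z \<in> cball 0 (R + r)" using norm_triangle_sub[of z x] by simp
    qed
  qed (use S(1) in \<open>auto simp: fmeasurable_compact intro!: sets.finite_UN\<close>)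
  also have "\<dots> = ?v * (R + r) ^ DIM('a)"
    using r R by (simp add: content_cball)
  finally have "real (card S) * r ^ DIM('a) \<le> (R + r) ^ DIM('a)"
    by (simp add: mult.left_commute)
  then show ?thesis using r by (simp add: power_divide field_simps)
qed

text \<open>The closed balls of radius \<open>\<delta> / 2\<close> about a largest
  \<open>\<delta> / 2\<close>-separated subset cover \<open>E\<close>, since a missed point could be
  added to it. The packing bound with \<open>r = \<delta> / 4\<close> counts them.\<close>

lemma ex_cover_card_le:
  fixes E :: "'a::euclidean_space set"
  assumes E: "E \<subseteq> cball 0 R" and R: "0 \<le> R" and \<delta>: "0 < \<delta>"
  shows "\<exists>C. finite C \<and> (\<forall>U\<in>C. bounded U \<and> diameter U \<le> \<delta>) \<and> E \<subseteq> \<Union>C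
    \<and> real (card C) \<le> ((R + \<delta> / 4) / (\<delta> / 4)) ^ DIM('a)"
proof -
  let ?B = "((R + \<delta> / 4) / (\<delta> / 4)) ^ DIM('a)"
  define sep where "sep S \<longleftrightarrow> finite S \<and> S \<subseteq> E \<and> (\<forall>x\<in>S. \<forall>y\<in>S. x \<noteq> y \<longrightarrow> \<delta> / 2 \<le> dist x y)"
    for S :: "'a set"
  have bd: "real (card S) \<le> ?B" if "sep S" for S
    using that E R \<delta> by (intro card_separated_le) (auto simp: sep_def)
  have "sep {}" by (simp add: sep_def)
  moreover have "\<forall>S. sep S \<longrightarrow> card S < Suc (nat \<lfloor>?B\<rfloor>)"
    using bd by (simp add: less_Suc_eq_le le_nat_floor)
  ultimately obtain S where S: "sep S" "\<And>S'. sep S' \<Longrightarrow> card S' \<le> card S"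
    using ex_has_greatest_nat[of sep "{}" card] by blast
  let ?C = "(\<lambda>x. cball x (\<delta> / 2)) ` S"
  have "E \<subseteq> \<Union>?C"
  proof
    fix z assume z: "z \<in> E"
    show "z \<in> \<Union>?C"
    proof (rule ccontr)
      assume "z \<notin> \<Union>?C"
      then have far: "\<And>x. x \<in> S \<Longrightarrow> \<delta> / 2 < dist x z" by auto
      then have "z \<notin> S" using \<delta> by force
      moreover have "sep (insert z S)"
        using S(1) z far by (fastforce simp: sep_def dist_commute)
      ultimately show False using S(2)[of "insert z S"] S(1) by (simp add: sep_def)
    qed
  qed
  moreover have "real (card ?C) \<le> ?B"
    using bd[OF S(1)] card_image_le[of S "\<lambda>x. cball x (\<delta> / 2)"] S(1) by (force simp: sep_def)
  ultimately show ?thesis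
    using S(1) \<delta> by (intro exI[of _ ?C]) (auto simp: sep_def)
qed

text \<open>Volume comparison again: each nonempty \<open>U\<close> lies in the closed ball of
  radius \<open>\<delta>\<close> about any of its points.\<close>

lemma card_cover_ge:
  fixes C :: "'a::euclidean_space set set"
  assumes C: "finite C" "\<And>U. U \<in> C \<Longrightarrow> bounded U \<and> diameter U \<le> \<delta>" "ball z r \<subseteq> \<Union>C"
    and \<delta>: "0 < \<delta>" and r: "0 < r"
  shows "(r / \<delta>) ^ DIM('a) \<le> real (card C)"
proof -
  let ?v = "unit_ball_vol (real DIM('a))"
  define c where "c U = (SOME x. x \<in> U)" for U :: "'a set"
  have "U \<subseteq> cball (c U) \<delta>" if "U \<in> C" for U
  proof
    fix x assume x: "x \<in> U"
    then have "c U \<in> U" unfolding c_def by (rule someI)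
    then show "x \<in> cball (c U) \<delta>"
      using diameter_bounded_bound[of U "c U" x] x C(2)[OF that] by auto
  qed
  then have sub: "ball z r \<subseteq> (\<Union>U\<in>C. cball (c U) \<delta>)" using C(3) by blast
  have "?v * r ^ DIM('a) = measure lborel (ball z r)"
    using r by (simp add: content_ball)
  also have "\<dots> \<le> measure lborel (\<Union>U\<in>C. cball (c U) \<delta>)"
    using C(1) sub by (intro measure_mono_fmeasurable fmeasurable.finite_UN) (auto simp: fmeasurable_compact)
  also have "\<dots> \<le> (\<Sum>U\<in>C. measure lborel (cball (c U) \<delta>))"
    using C(1) by (intro measure_UNION_le) auto
  also have "\<dots> = real (card C) * (?v * \<delta> ^ DIM('a))"
    using \<delta> by (simp add: content_cball)
  finally have "r ^ DIM('a) \<le> real (card C) * \<delta> ^ DIM('a)"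
    by (simp add: mult.left_commute)
  then show ?thesis using \<delta> by (simp add: power_divide field_simps)
qed

text \<open>The covering number lies between constant multiples of \<open>\<delta>\<close> to the
  power \<open>- DIM('a)\<close> for small \<open>\<delta>\<close>; the constants vanish in the
  logarithmic quotient.\<close>

lemma has_box_dimension_full:
  fixes E :: "'a::euclidean_space set"
  assumes bdd: "bounded E" and int: "interior E \<noteq> {}"
  shows "has_box_dimension E (DIM('a))"
proof -
  let ?n = "DIM('a)"
  obtain z r where z: "0 < r" "ball z r \<subseteq> E"
    using int by (metis ex_in_conv mem_interior)
  obtain R where R: "0 < R" "E \<subseteq> cball 0 R"
    using bdd by (metis bounded_pos mem_cball_0 subsetI)
  let ?N = "\<lambda>\<delta>. real (covering_number \<delta> E)"
  have N: "(r / \<delta>) ^ ?n \<le> ?N \<delta> \<and> ?N \<delta> \<le> ((R + \<delta> / 4) / (\<delta> / 4)) ^ ?n" if \<delta>: "0 < \<delta>" for \<delta>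
  proof -
    let ?Q = "\<lambda>n. \<exists>C. finite C \<and> card C = n \<and> (\<forall>U\<in>C. bounded U \<and> diameter U \<le> \<delta>) \<and> E \<subseteq> \<Union>C"
    obtain C where C: "finite C" "\<forall>U\<in>C. bounded U \<and> diameter U \<le> \<delta>" "E \<subseteq> \<Union>C"
      "real (card C) \<le> ((R + \<delta> / 4) / (\<delta> / 4)) ^ ?n"
      using ex_cover_card_le[OF R(2) _ \<delta>] R(1) by auto
    then have Q: "?Q (card C)" by blast
    have "?Q (covering_number \<delta> E)"
      unfolding covering_number_def by (rule LeastI[of ?Q, OF Q])
    then have "(r / \<delta>) ^ ?n \<le> ?N \<delta>"
      using card_cover_ge[of _ \<delta> z r] z \<delta> by (metis subset_trans)
    moreover have "covering_number \<delta> E \<le> card C"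
      unfolding covering_number_def by (rule Least_le[of ?Q, OF Q])
    ultimately show ?thesis using C(4) by linarith
  qed
  have "((\<lambda>\<delta>. ln (?N \<delta>) / - ln \<delta>) \<longlongrightarrow> real ?n) (at_right 0)"
  proof (rule tendsto_sandwich)
    show "((\<lambda>\<delta>. real ?n * (ln r - ln \<delta>) / - ln \<delta>) \<longlongrightarrow> real ?n) (at_right 0)"
      by real_asymp
    show "((\<lambda>\<delta>. real ?n * (ln (4 * R + 1) - ln \<delta>) / - ln \<delta>) \<longlongrightarrow> real ?n) (at_right 0)"
      by real_asymp
    have small: "\<forall>\<^sub>F \<delta>::real in at_right 0. 0 < \<delta> \<and> \<delta> < 1"
      using eventually_at_right_real[of 0 1] by simp
    show "\<forall>\<^sub>F \<delta> in at_right 0. real ?n * (ln r - ln \<delta>) / - ln \<delta> \<le> ln (?N \<delta>) / - ln \<delta>"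
      using small
    proof eventually_elim
      case (elim \<delta>)
      have pos: "0 < (r / \<delta>) ^ ?n" using z elim by simp
      have "real ?n * (ln r - ln \<delta>) = ln ((r / \<delta>) ^ ?n)"
        using z elim by (simp add: ln_realpow ln_div)
      also have "\<dots> \<le> ln (?N \<delta>)"
        using N[of \<delta>] elim pos by (intro ln_mono) auto
      finally show ?case using elim by (intro divide_right_mono) auto
    qed
    show "\<forall>\<^sub>F \<delta> in at_right 0. ln (?N \<delta>) / - ln \<delta> \<le> real ?n * (ln (4 * R + 1) - ln \<delta>) / - ln \<delta>"
      using small
    proof eventually_elim
      case (elim \<delta>)
      have pos: "0 < ?N \<delta>" using N[of \<delta>] z elim by (smt (verit) divide_pos_pos zero_less_power)
      have "?N \<delta> \<le> ((R + \<delta> / 4) / (\<delta> / 4)) ^ ?n" using N[of \<delta>] elim by simp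
      also have "\<dots> \<le> ((4 * R + 1) / \<delta>) ^ ?n"
        using elim R by (intro power_mono) (auto simp: field_simps)
      finally have "ln (?N \<delta>) \<le> ln (((4 * R + 1) / \<delta>) ^ ?n)" using pos by (intro ln_mono)
      also have "\<dots> = real ?n * (ln (4 * R + 1) - ln \<delta>)"
        using R elim by (simp add: ln_realpow ln_div)
      finally show ?case using elim by (intro divide_right_mono) auto
    qed
  qed
  moreover have "E \<noteq> {}" using z by auto
  ultimately show ?thesis using bdd by (simp add: has_box_dimension_def)
qed

section \<open>A backward invariant lens\<close>

text \<open>The parabolic regions for \<open>k = 19/20\<close> also meet far away, for example at
  (2, 1). The coordinate bounds select the bounded piece with tips near x = 0.003 and x =
  0.3.\<close>

definition lens :: "(real \<times> real) set" where
  "lens = {p. 0 \<le> fst p \<and> fst p \<le> 1 / 2 \<and> 0 \<le> snd p \<and> snd p \<le> 1 \<and>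
     (snd p)\<^sup>2 \<le> 19 / 20 * fst p \<and> 1 - snd p \<le> 19 / 20 * (1 - fst p)\<^sup>2}"

lemma compact_lens: "compact lens"
proof -
  have "closed lens"
    unfolding lens_def by (intro closed_Collect_conj closed_Collect_le continuous_intros)
  moreover have "lens \<subseteq> {0..1} \<times> {0..1}" by (auto simp: lens_def)
  moreover have "compact ({0..1} \<times> {0..1} :: (real \<times> real) set)" by (intro compact_Times) auto
  ultimately show ?thesis by (metis compact_Int_closed inf.absorb_iff2)
qed

lemma interior_lens: "interior lens \<noteq> {}"
proof -
  \<comment> \<open>Over x = 8/100 the lens spans roughly 0.196 < y < 0.276.\<close>
  have "{7/100<..<9/100} \<times> {22/100<..<24/100} \<subseteq> lens"
  proof clarify
    fix x y :: real
    assume "x \<in> {7/100<..<9/100}" "y \<in> {22/100<..<24/100}"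
    then have *: "7/100 < x" "x < 9/100" "22/100 < y" "y < 24/100" by auto
    have "y\<^sup>2 \<le> (24/100)\<^sup>2" using * by (intro power_mono) auto
    moreover have "(91/100)\<^sup>2 \<le> (1 - x)\<^sup>2" using * by (intro power_mono) auto
    ultimately show "(x, y) \<in> lens" using * by (simp add: lens_def power_divide)
  qed
  then have "{7/100<..<9/100} \<times> {22/100<..<24/100} \<subseteq> interior lens"
    by (intro interior_maximal open_Times) auto
  moreover have "(8/100, 23/100) \<in> {7/100<..<9/100::real} \<times> {22/100<..<24/100::real}" by simp
  ultimately show ?thesis by blast
qed

text \<open>The line \<open>y = 7/200 + 5/2 x\<close> decides which inverse is applied: it enters the lens through
  the lower arc and leaves it through the upper one, separating the points near the upper arc, where
  the inverse of \<open>T\<^sub>0\<close> is used, from those near the lower arc. At \<open>x = 1/40\<close> and \<open>y = 8/25\<close> the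
  estimates switch from using an arc of the lens to using the line.\<close>
lemma lens_backward_invariant:
  defines "mu \<equiv> 99 / 100 :: real"
  shows "lens \<subseteq> T0 (mu\<^sup>2) mu ` lens \<union> T1 (mu\<^sup>2) mu ` lens"
proof clarify
  fix x y assume p: "(x, y) \<in> lens" and not1: "(x, y) \<notin> T1 (mu\<^sup>2) mu ` lens"
  have x: "0 \<le> x" "x \<le> 1/2" and y: "0 \<le> y" "y \<le> 1" and up: "y * y \<le> 19/20 * x"
    and low: "1 - y \<le> 19/20 - 19/10 * x + 19/20 * (x * x)"
    using p by (auto simp: lens_def power2_eq_square algebra_simps)
  have y7: "y < 7/10"
  proof (rule ccontr)
    assume "\<not> y < 7/10"
    then have "7/10 * (7/10) \<le> y * y" by (intro mult_mono) auto
    then show False using up x by simp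
  qed
  show "(x, y) \<in> T0 (mu\<^sup>2) mu ` lens"
  proof (cases "7/200 + 5/2 * x \<le> y")
    case True
    \<comment> \<open>This keeps \<open>x / mu\<^sup>2\<close> below 1/2. The number 107/200 below
      is the height of the line at x = 1/5.\<close>
    have x2: "x < 1/5"
    proof (rule ccontr)
      assume "\<not> x < 1/5"
      then have "107/200 * (7/200 + 5/2 * x) \<le> y * y" using True by (intro mult_mono) auto
      then show False using up \<open>\<not> x < 1/5\<close> by simp
    qed
    have sq: "(1 - x / mu\<^sup>2)\<^sup>2 = 1 - 20000/9801 * x + 100000000/96059601 * (x * x)"
      by (simp add: mu_def power2_eq_square field_simps)
    have y_div: "y / mu = 100/99 * y" by (simp add: mu_def)
    have "1 - y / mu \<le> 19/20 * (1 - x / mu\<^sup>2)\<^sup>2"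
    \<comment> \<open>The lower arc alone suffices only up to about x = 0.027. Further right the
      line bounds \<open>y\<close> from below, and \<open>x * x\<close> is bounded below by its
      tangent at 1/40.\<close>
    proof (cases "x \<le> 1/40")
      case True
      then show ?thesis using low x mult_nonneg_nonneg[OF x(1) x(1)]
        unfolding sq y_div right_diff_distrib distrib_left by linarith
    next
      case False
      have "0 \<le> (x - 1/40) * (x - 1/40)" by simp
      then show ?thesis using False \<open>7/200 + 5/2 * x \<le> y\<close>
        unfolding sq y_div by (simp add: algebra_simps)
    qed
    then have "(x / mu\<^sup>2, y / mu) \<in> lens"
      using x y up y7 x2 by (simp add: lens_def mu_def power2_eq_square)
    moreover have "(x, y) = T0 (mu\<^sup>2) mu (x / mu\<^sup>2, y / mu)" by (simp add: T0_def mu_def)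
    ultimately show ?thesis by blast
  next
    case False
    have x02: "1/50 \<le> x"
    proof (rule ccontr)
      assume "\<not> 1/50 \<le> x"
      then have "0 \<le> x * (1/50 - x)" using x by simp
      then show False using low False \<open>\<not> 1/50 \<le> x\<close> by (simp add: algebra_simps)
    qed
    \<comment> \<open>By convexity \<open>x * x\<close> lies below its chord over [1/50, 1/2], which
      makes the bound on \<open>y\<close> linear.\<close>
    have "0 \<le> (x - 1/50) * (1/2 - x)" using x x02 by simp
    then have "x * x \<le> 13/25 * x - 1/100" by (simp add: field_simps)
    then have y08: "8/100 \<le> y" using low x02 by linarith
    define x' y' where "x' = 1 - (1 - x) / mu" and "y' = 1 - (1 - y) / mu\<^sup>2"
    have sq: "y'\<^sup>2 = 100000000/96059601 * (y * y) - 3980000/96059601 * y + 39601/96059601"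
      by (simp add: y'_def mu_def power2_eq_square field_simps)
    have x'_eq: "19/20 * x' = 95/99 * x - 19/1980"
      by (simp add: x'_def mu_def field_simps)
    have "y'\<^sup>2 \<le> 19/20 * x'"
    \<comment> \<open>The upper arc alone suffices once \<open>y\<close> is at least about 0.317;
      below 8/25 the line bounds \<open>x\<close> from below instead. In both cases a chord replaces
      \<open>y * y\<close>, leaving linear arithmetic.\<close>
    proof (cases "y \<le> 8/25")
      case True
      then have "0 \<le> (y - 8/100) * (8/25 - y)" using y08 by simp
      then have "y * y \<le> 2/5 * y - 16/625" by (simp add: field_simps)
      then show ?thesis using False True y08 unfolding sq x'_eq by linarith
    next
      case False
      then have "0 \<le> (y - 8/25) * (7/10 - y)" using y7 by simp
      then have "y * y \<le> 51/50 * y - 28/125" by (simp add: field_simps)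
      then show ?thesis using False up y7 unfolding sq x'_eq by linarith
    qed
    moreover have "1 - y' \<le> 19/20 * (1 - x')\<^sup>2"
      using low by (simp add: x'_def y'_def mu_def power2_eq_square field_simps)
    moreover have "0 \<le> x'" "x' \<le> 1/2" "0 \<le> y'" "y' \<le> 1"
      using x y x02 y08 by (simp_all add: x'_def y'_def mu_def power2_eq_square field_simps)
    ultimately have "(x', y') \<in> lens" by (simp add: lens_def)
    moreover have "(x, y) = T1 (mu\<^sup>2) mu (x', y')"
      by (simp add: T1_def x'_def y'_def mu_def field_simps)
    ultimately show ?thesis using not1 by blast
  qed
qed

theorem theorem1p3:
  "\<exists>lam mu :: real. 0 < lam \<and> lam < mu \<and> mu < 1 \<and> lam + mu > 1 \<and>
     (\<exists>d. has_box_dimension (attractor lam mu) d \<and> d > 1)"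
proof (intro exI conjI)
  define mu :: real where "mu = 99 / 100"
  show par: "0 < mu\<^sup>2" "mu\<^sup>2 < mu" "mu < 1" "mu\<^sup>2 + mu > 1"
    by (simp_all add: mu_def power2_eq_square)
  have "lens \<subseteq> attractor (mu\<^sup>2) mu"
    using par(1-3) compact_lens lens_backward_invariant[folded mu_def]
    by (rule backward_invariant_subset_attractor)
  then have "interior (attractor (mu\<^sup>2) mu) \<noteq> {}"
    using interior_mono interior_lens by blast
  then show "has_box_dimension (attractor (mu\<^sup>2) mu) (real DIM(real \<times> real))"
    using attractor_invariant[OF par(1-3)] by (intro has_box_dimension_full compact_imp_bounded) auto
  show "1 < real DIM(real \<times> real)" by simp
qed

end
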